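(* Let $\mathcal{K}$ be a 2-category, let $g\colon x\to y$ be a 1-cell of $\mathcal{K}$, $t$ a monad on $x$, and $s$ a $g$-determined monad on $y$. If the pushforward $g_\#t$ exists, with counit $\varepsilon\colon(g_\#t)g\to gt$, then right extending along $g$, that is, sending $(g,\psi)$ to the unique 2-cell $\widehat\psi\colon g_\#t\to s$ such that $\widehat\psi g=\psi\cdot\varepsilon$, gives a function $$\mathsf{Colax}_g(t,s)\to\mathsf{Mnd}_y(g_\#t,s)$$ natural in $t$ and $s$. Moreover, it takes monic 2-cells to monic 2-cells (if $\psi$ is a monomorphism in $\mathcal{K}(x,y)$, then $\widehat\psi$ is a monomorphism in $\mathcal{K}(y,y)$).
   Context: Notation: $\cdot$ is vertical and $*$ horizontal composition of 2-cells. A right extension of a 1-cell $k\colon x\to z$ along $g\colon x\to y$ is a pair $(r,\varepsilon)$ with $r\colon y\to z$ and $\varepsilon\colon rg\to k$ such that for every $r'\colon y\to z$ and $\alpha\colon r'g\to k$ there is a unique $\widehat\alpha\colon r'\to r$ with $\varepsilon\cdot\widehat\alpha g=\alpha$. Pushforward: for a monad $(t,\eta^t,\mu^t)$ on $x$ and $g\colon x\to y$, $g_\#t$ is, when it exists, the right extension $(g_\#t,\varepsilon)$ of $gt$ along $g$, with the unique monad structure such that $\varepsilon\cdot\eta^{g_\#t}g=g\eta^t$ and $\varepsilon\cdot\mu^{g_\#t}g=g\mu^t\cdot\varepsilon t\cdot(g_\#t)\varepsilon$; $\varepsilon$ is its counit. It is functorial in $t$: for a monad map $\theta\colon t\to t'$,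 $g_\#\theta$ is the unique 2-cell with $\varepsilon'\cdot(g_\#\theta)g=g\theta\cdot\varepsilon$. A 1-cell $h\colon y\to z$ is $g$-determined if $(h,1_{hg})$ is a right extension of $hg$ along $g$; a monad on $y$ is $g$-determined if its underlying 1-cell is. $\mathsf{Colax}_g(t,s)$ is the collection of colax transformations with 1-cell part $g$: pairs $(g,\psi)$ with $\psi\colon gt\to sg$ such that $\psi\cdot g\eta^t=\eta^sg$ and $\psi\cdot g\mu^t=\mu^sg\cdot s\psi\cdot\psi t$. $\mathsf{Mnd}_y(s',s)$ is the collection of monad maps: 2-cells $\theta\colon s'\to s$ with $\theta\cdot\eta^{s'}=\eta^s$ and $\theta\cdot\mu^{s'}=\mu^s\cdot(\theta*\theta)$. Naturality in $t$ is with respect to monad maps between monads on $x$ whose pushforward along $g$ exists (acting by $\psi\mapsto\psi\cdot g\theta$ on the left and by precomposition with $g_\#\theta$ on the right); naturality in $s$ is with respect to monad maps between $g$-determined monads on $y$ (acting by $\psi\mapsto\theta g\cdot\psi$ on the left and by postcomposition on the right). *)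

theory Defs
  imports Main "HOL-Library.FuncSet"
begin

section \<open>Strict 2-categories\<close>

text \<open>
  All cells carry their boundaries: a 1-cell \<open>f\<close> goes from the 0-cell \<open>src K f\<close> to \<open>trg K f\<close>,
  a 2-cell \<open>\<alpha>\<close> from the 1-cell \<open>dom2 K \<alpha>\<close> to \<open>cod2 K \<alpha>\<close>.  In all
  compositions the right-hand factor comes first; composites of non-composable cells are junk.
\<close>

record ('o, 'm, 'c) two_cat =
  Ob :: "'o set"
  One :: "'m set"
  Two :: "'c set"
  src :: "'m \<Rightarrow> 'o"
  trg :: "'m \<Rightarrow> 'o"
  dom2 :: "'c \<Rightarrow> 'm"
  cod2 :: "'c \<Rightarrow> 'm"
  id1 :: "'o \<Rightarrow> 'm"
  comp1 :: "'m \<Rightarrow> 'm \<Rightarrow> 'm" (infixr "\<odot>\<index>" 75)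
  id2 :: "'m \<Rightarrow> 'c"
  vcomp :: "'c \<Rightarrow> 'c \<Rightarrow> 'c" (infixr "\<cdot>\<index>" 65)
  hcomp :: "'c \<Rightarrow> 'c \<Rightarrow> 'c" (infixr "\<star>\<index>" 75)

definition hom1 :: "('o, 'm, 'c) two_cat \<Rightarrow> 'o \<Rightarrow> 'o \<Rightarrow> 'm set" where
  "hom1 K x y = {f \<in> One K. src K f = x \<and> trg K f = y}"

definition hom2 :: "('o, 'm, 'c) two_cat \<Rightarrow> 'm \<Rightarrow> 'm \<Rightarrow> 'c set" where
  "hom2 K f g = {\<alpha> \<in> Two K. dom2 K \<alpha> = f \<and> cod2 K \<alpha> = g}"

locale two_category =
  fixes K :: "('o, 'm, 'c) two_cat" (structure)
  assumes src_Ob: "f \<in> One K \<Longrightarrow> src K f \<in> Ob K"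
    and trg_Ob: "f \<in> One K \<Longrightarrow> trg K f \<in> Ob K"
    and id1_hom: "x \<in> Ob K \<Longrightarrow> id1 K x \<in> hom1 K x x"
    and comp1_hom: "\<lbrakk>f \<in> hom1 K x y; g \<in> hom1 K y z\<rbrakk> \<Longrightarrow> g \<odot> f \<in> hom1 K x z"
    and comp1_id_right: "f \<in> hom1 K x y \<Longrightarrow> f \<odot> id1 K x = f"
    and comp1_id_left: "f \<in> hom1 K x y \<Longrightarrow> id1 K y \<odot> f = f"
    and comp1_assoc:
      "\<lbrakk>f \<in> hom1 K w x; g \<in> hom1 K x y; h \<in> hom1 K y z\<rbrakk> \<Longrightarrow> (h \<odot> g) \<odot> f = h \<odot> (g \<odot> f)"
    and dom2_One: "\<alpha> \<in> Two K \<Longrightarrow> dom2 K \<alpha> \<in> One K"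
    and cod2_parallel:
      "\<alpha> \<in> Two K \<Longrightarrow> cod2 K \<alpha> \<in> hom1 K (src K (dom2 K \<alpha>)) (trg K (dom2 K \<alpha>))"
    and id2_hom: "f \<in> One K \<Longrightarrow> id2 K f \<in> hom2 K f f"
    and vcomp_hom: "\<lbrakk>\<alpha> \<in> hom2 K f g; \<beta> \<in> hom2 K g h\<rbrakk> \<Longrightarrow> \<beta> \<cdot> \<alpha> \<in> hom2 K f h"
    and vcomp_id_right: "\<alpha> \<in> hom2 K f g \<Longrightarrow> \<alpha> \<cdot> id2 K f = \<alpha>"
    and vcomp_id_left: "\<alpha> \<in> hom2 K f g \<Longrightarrow> id2 K g \<cdot> \<alpha> = \<alpha>"
    and vcomp_assoc:
      "\<lbrakk>\<alpha> \<in> hom2 K f g; \<beta> \<in> hom2 K g h; \<gamma> \<in> hom2 K h k\<rbrakk> \<Longrightarrow> (\<gamma> \<cdot> \<beta>) \<cdot> \<alpha> = \<gamma> \<cdot> (\<beta> \<cdot> \<alpha>)"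
    and hcomp_hom:
      "\<lbrakk>f \<in> hom1 K x y; g \<in> hom1 K y z; \<alpha> \<in> hom2 K f f'; \<beta> \<in> hom2 K g g'\<rbrakk>
        \<Longrightarrow> \<beta> \<star> \<alpha> \<in> hom2 K (g \<odot> f) (g' \<odot> f')"
    and hcomp_id2:
      "\<lbrakk>f \<in> hom1 K x y; g \<in> hom1 K y z\<rbrakk> \<Longrightarrow> id2 K g \<star> id2 K f = id2 K (g \<odot> f)"
    and interchange:
      "\<lbrakk>f \<in> hom1 K x y; g \<in> hom1 K y z; \<alpha> \<in> hom2 K f f'; \<alpha>' \<in> hom2 K f' f'';
        \<beta> \<in> hom2 K g g'; \<beta>' \<in> hom2 K g' g''\<rbrakk>
        \<Longrightarrow> (\<beta>' \<cdot> \<beta>) \<star> (\<alpha>' \<cdot> \<alpha>) = (\<beta>' \<star> \<alpha>') \<cdot> (\<beta> \<star> \<alpha>)"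
    and hcomp_id_right: "\<lbrakk>f \<in> hom1 K x y; \<alpha> \<in> hom2 K f f'\<rbrakk> \<Longrightarrow> \<alpha> \<star> id2 K (id1 K x) = \<alpha>"
    and hcomp_id_left: "\<lbrakk>f \<in> hom1 K x y; \<alpha> \<in> hom2 K f f'\<rbrakk> \<Longrightarrow> id2 K (id1 K y) \<star> \<alpha> = \<alpha>"
    and hcomp_assoc:
      "\<lbrakk>f \<in> hom1 K w x; g \<in> hom1 K x y; h \<in> hom1 K y z;
        \<alpha> \<in> hom2 K f f'; \<beta> \<in> hom2 K g g'; \<gamma> \<in> hom2 K h h'\<rbrakk>
        \<Longrightarrow> (\<gamma> \<star> \<beta>) \<star> \<alpha> = \<gamma> \<star> (\<beta> \<star> \<alpha>)"

abbreviation whisker_left :: "('o, 'm, 'c) two_cat \<Rightarrow> 'm \<Rightarrow> 'c \<Rightarrow> 'c" (infixr "\<rhd>\<index>" 75)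
  where "g \<rhd>\<^bsub>K\<^esub> \<alpha> \<equiv> id2 K g \<star>\<^bsub>K\<^esub> \<alpha>"

abbreviation whisker_right :: "('o, 'm, 'c) two_cat \<Rightarrow> 'c \<Rightarrow> 'm \<Rightarrow> 'c" (infixl "\<lhd>\<index>" 75)
  where "\<alpha> \<lhd>\<^bsub>K\<^esub> g \<equiv> \<alpha> \<star>\<^bsub>K\<^esub> id2 K g"


section \<open>Monads, right extensions and pushforwards\<close>

record ('m, 'c) mnd =
  under :: 'm
  eta :: 'c
  mu :: 'c

context
  fixes K :: "('o, 'm, 'c) two_cat" (structure)
begin

definition monic :: "'o \<Rightarrow> 'o \<Rightarrow> 'c \<Rightarrow> bool" where
  "monic x y \<psi> \<longleftrightarrow> (\<exists>f\<in>hom1 K x y. \<exists>f'\<in>hom1 K x y. \<psi> \<in> hom2 K f f' \<and>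
     (\<forall>h\<in>hom1 K x y. \<forall>\<alpha>\<in>hom2 K h f. \<forall>\<beta>\<in>hom2 K h f. \<psi> \<cdot> \<alpha> = \<psi> \<cdot> \<beta> \<longrightarrow> \<alpha> = \<beta>))"

definition monad :: "'o \<Rightarrow> ('m, 'c) mnd \<Rightarrow> bool" where
  "monad x t \<longleftrightarrow>
     x \<in> Ob K \<and> under t \<in> hom1 K x x \<and>
     eta t \<in> hom2 K (id1 K x) (under t) \<and> mu t \<in> hom2 K (under t \<odot> under t) (under t) \<and>
     mu t \<cdot> (eta t \<lhd> under t) = id2 K (under t) \<and>
     mu t \<cdot> (under t \<rhd> eta t) = id2 K (under t) \<and>
     mu t \<cdot> (mu t \<lhd> under t) = mu t \<cdot> (under t \<rhd> mu t)"

definition right_extension :: "'m \<Rightarrow> 'm \<Rightarrow> 'm \<Rightarrow> 'c \<Rightarrow> bool" where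
  "right_extension g k r \<epsilon> \<longleftrightarrow>
     g \<in> One K \<and> k \<in> One K \<and> src K g = src K k \<and>
     r \<in> hom1 K (trg K g) (trg K k) \<and> \<epsilon> \<in> hom2 K (r \<odot> g) k \<and>
     (\<forall>r'\<in>hom1 K (trg K g) (trg K k). \<forall>\<alpha>\<in>hom2 K (r' \<odot> g) k.
        \<exists>!\<chi>. \<chi> \<in> hom2 K r' r \<and> \<epsilon> \<cdot> (\<chi> \<lhd> g) = \<alpha>)"

definition determined :: "'m \<Rightarrow> 'm \<Rightarrow> bool" where
  "determined g h \<longleftrightarrow>
     g \<in> One K \<and> h \<in> One K \<and> src K h = trg K g \<and> right_extension g (h \<odot> g) h (id2 K (h \<odot> g))"

text \<open>
  \<open>pushforward g t p \<epsilon>\<close>: the monad \<open>p\<close> is the pushforward \<open>g\<^sub># t\<close>, with counit \<open>\<epsilon>\<close>.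
  The monad structure is determined by the right extension and is always available once the
  latter exists; see \<open>pushforward_ex1\<close> below.
\<close>

definition pushforward :: "'m \<Rightarrow> ('m, 'c) mnd \<Rightarrow> ('m, 'c) mnd \<Rightarrow> 'c \<Rightarrow> bool" where
  "pushforward g t p \<epsilon> \<longleftrightarrow>
     right_extension g (g \<odot> under t) (under p) \<epsilon> \<and> monad (trg K g) p \<and>
     \<epsilon> \<cdot> (eta p \<lhd> g) = g \<rhd> eta t \<and>
     \<epsilon> \<cdot> (mu p \<lhd> g) = (g \<rhd> mu t) \<cdot> (\<epsilon> \<lhd> under t) \<cdot> (under p \<rhd> \<epsilon>)"

definition Mnd :: "('m, 'c) mnd \<Rightarrow> ('m, 'c) mnd \<Rightarrow> 'c set" where
  "Mnd s' s = {\<theta> \<in> hom2 K (under s') (under s).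
     \<theta> \<cdot> eta s' = eta s \<and> \<theta> \<cdot> mu s' = mu s \<cdot> (\<theta> \<star> \<theta>)}"

definition Colax :: "'m \<Rightarrow> ('m, 'c) mnd \<Rightarrow> ('m, 'c) mnd \<Rightarrow> ('m \<times> 'c) set" where
  "Colax g t s = {(g, \<psi>) | \<psi>. \<psi> \<in> hom2 K (g \<odot> under t) (under s \<odot> g) \<and>
     \<psi> \<cdot> (g \<rhd> eta t) = eta s \<lhd> g \<and>
     \<psi> \<cdot> (g \<rhd> mu t) = (mu s \<lhd> g) \<cdot> (under s \<rhd> \<psi>) \<cdot> (\<psi> \<lhd> under t)}"

text \<open>
  For a monad map \<open>\<theta>\<close> from \<open>t\<close> to \<open>t'\<close>, with pushforwards \<open>(p, \<epsilon>)\<close> and \<open>(p', \<epsilon>')\<close>, the 2-cell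
  \<open>pushforward_map g p \<epsilon> p' \<epsilon>' \<theta>\<close> is \<open>g\<^sub># \<theta>\<close>.
\<close>

definition pushforward_map ::
    "'m \<Rightarrow> ('m, 'c) mnd \<Rightarrow> 'c \<Rightarrow> ('m, 'c) mnd \<Rightarrow> 'c \<Rightarrow> 'c \<Rightarrow> 'c" where
  "pushforward_map g p \<epsilon> p' \<epsilon>' \<theta> =
     (THE \<chi>. \<chi> \<in> hom2 K (under p) (under p') \<and> \<epsilon>' \<cdot> (\<chi> \<lhd> g) = (g \<rhd> \<theta>) \<cdot> \<epsilon>)"

definition colax_pre :: "'c \<Rightarrow> 'm \<times> 'c \<Rightarrow> 'm \<times> 'c" where
  "colax_pre \<theta> = (\<lambda>(g, \<psi>). (g, \<psi> \<cdot> (g \<rhd> \<theta>)))"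

definition colax_post :: "'c \<Rightarrow> 'm \<times> 'c \<Rightarrow> 'm \<times> 'c" where
  "colax_post \<theta> = (\<lambda>(g, \<psi>). (g, (\<theta> \<lhd> g) \<cdot> \<psi>))"

text \<open>\<open>right_extend p \<epsilon> s\<close> is meant for the pushforward \<open>(p, \<epsilon>)\<close> of the source monad.\<close>

definition right_extend ::
    "('m, 'c) mnd \<Rightarrow> 'c \<Rightarrow> ('m, 'c) mnd \<Rightarrow> 'm \<times> 'c \<Rightarrow> 'c" where
  "right_extend p \<epsilon> s = (\<lambda>(g, \<psi>).
     THE \<chi>. \<chi> \<in> hom2 K (under p) (under s) \<and> \<chi> \<lhd> g = \<psi> \<cdot> \<epsilon>)"

end

section \<open>Well-definedness of the notions above\<close>

context two_category
begin

lemma hom1_I: "f \<in> One K \<Longrightarrow> src K f = x \<Longrightarrow> trg K f = y \<Longrightarrow> f \<in> hom1 K x y"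
  by (simp add: hom1_def)

lemma hom2_I: "\<alpha> \<in> Two K \<Longrightarrow> dom2 K \<alpha> = f \<Longrightarrow> cod2 K \<alpha> = g \<Longrightarrow> \<alpha> \<in> hom2 K f g"
  by (simp add: hom2_def)

lemma boundaries:
  "\<alpha> \<in> Two K \<Longrightarrow> dom2 K \<alpha> \<in> One K"
  "\<alpha> \<in> Two K \<Longrightarrow> cod2 K \<alpha> \<in> One K"
  "\<alpha> \<in> Two K \<Longrightarrow> src K (cod2 K \<alpha>) = src K (dom2 K \<alpha>)"
  "\<alpha> \<in> Two K \<Longrightarrow> trg K (cod2 K \<alpha>) = trg K (dom2 K \<alpha>)"
  using dom2_One cod2_parallel[of \<alpha>] by (auto simp: hom1_def)

lemma id1_boundary:
  assumes "x \<in> Ob K"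
  shows "id1 K x \<in> One K" "src K (id1 K x) = x" "trg K (id1 K x) = x"
  using id1_hom[OF assms] by (auto simp: hom1_def)

lemma comp1_boundary:
  assumes "f \<in> One K" "g \<in> One K" "src K g = trg K f"
  shows "g \<odot> f \<in> One K" "src K (g \<odot> f) = src K f" "trg K (g \<odot> f) = trg K g"
  using comp1_hom[of f "src K f" "src K g" g "trg K g"] assms by (auto simp: hom1_def)

lemma comp1_laws:
  "f \<in> One K \<Longrightarrow> src K f = x \<Longrightarrow> f \<odot> id1 K x = f"
  "f \<in> One K \<Longrightarrow> trg K f = y \<Longrightarrow> id1 K y \<odot> f = f"
  "f \<in> One K \<Longrightarrow> g \<in> One K \<Longrightarrow> h \<in> One K \<Longrightarrow> src K g = trg K f \<Longrightarrow> src K h = trg K g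
    \<Longrightarrow> (h \<odot> g) \<odot> f = h \<odot> (g \<odot> f)"
  using comp1_id_right comp1_id_left comp1_assoc by (auto simp: hom1_def)

lemma id2_boundary:
  assumes "f \<in> One K"
  shows "id2 K f \<in> Two K" "dom2 K (id2 K f) = f" "cod2 K (id2 K f) = f"
  using id2_hom[OF assms] by (auto simp: hom2_def)

lemma vcomp_boundary:
  assumes "\<alpha> \<in> Two K" "\<beta> \<in> Two K" "dom2 K \<beta> = cod2 K \<alpha>"
  shows "\<beta> \<cdot> \<alpha> \<in> Two K" "dom2 K (\<beta> \<cdot> \<alpha>) = dom2 K \<alpha>" "cod2 K (\<beta> \<cdot> \<alpha>) = cod2 K \<beta>"
  using vcomp_hom[of \<alpha> "dom2 K \<alpha>" "cod2 K \<alpha>" \<beta> "cod2 K \<beta>"] assms by (auto simp: hom2_def)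

lemma vcomp_laws:
  "\<alpha> \<in> Two K \<Longrightarrow> dom2 K \<alpha> = f \<Longrightarrow> \<alpha> \<cdot> id2 K f = \<alpha>"
  "\<alpha> \<in> Two K \<Longrightarrow> cod2 K \<alpha> = f \<Longrightarrow> id2 K f \<cdot> \<alpha> = \<alpha>"
  "\<alpha> \<in> Two K \<Longrightarrow> \<beta> \<in> Two K \<Longrightarrow> \<gamma> \<in> Two K \<Longrightarrow> dom2 K \<beta> = cod2 K \<alpha> \<Longrightarrow> dom2 K \<gamma> = cod2 K \<beta>
    \<Longrightarrow> (\<gamma> \<cdot> \<beta>) \<cdot> \<alpha> = \<gamma> \<cdot> (\<beta> \<cdot> \<alpha>)"
  using vcomp_id_right vcomp_id_left vcomp_assoc by (auto simp: hom2_def)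

lemma hcomp_boundary:
  assumes "\<alpha> \<in> Two K" "\<beta> \<in> Two K" "src K (dom2 K \<beta>) = trg K (dom2 K \<alpha>)"
  shows "\<beta> \<star> \<alpha> \<in> Two K" "dom2 K (\<beta> \<star> \<alpha>) = dom2 K \<beta> \<odot> dom2 K \<alpha>"
    "cod2 K (\<beta> \<star> \<alpha>) = cod2 K \<beta> \<odot> cod2 K \<alpha>"
  using hcomp_hom[of "dom2 K \<alpha>" "src K (dom2 K \<alpha>)" "src K (dom2 K \<beta>)" "dom2 K \<beta>"
      "trg K (dom2 K \<beta>)" \<alpha> "cod2 K \<alpha>" \<beta> "cod2 K \<beta>"] assms boundaries
  by (auto simp: hom1_def hom2_def)

lemma hcomp_laws:
  "\<alpha> \<in> Two K \<Longrightarrow> src K (dom2 K \<alpha>) = x \<Longrightarrow> \<alpha> \<star> id2 K (id1 K x) = \<alpha>"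
  "\<alpha> \<in> Two K \<Longrightarrow> trg K (dom2 K \<alpha>) = y \<Longrightarrow> id2 K (id1 K y) \<star> \<alpha> = \<alpha>"
  "f \<in> One K \<Longrightarrow> g \<in> One K \<Longrightarrow> src K g = trg K f \<Longrightarrow> id2 K g \<star> id2 K f = id2 K (g \<odot> f)"
  "\<alpha> \<in> Two K \<Longrightarrow> \<beta> \<in> Two K \<Longrightarrow> \<gamma> \<in> Two K \<Longrightarrow> src K (dom2 K \<beta>) = trg K (dom2 K \<alpha>)
    \<Longrightarrow> src K (dom2 K \<gamma>) = trg K (dom2 K \<beta>) \<Longrightarrow> (\<gamma> \<star> \<beta>) \<star> \<alpha> = \<gamma> \<star> (\<beta> \<star> \<alpha>)"
  using hcomp_id_right hcomp_id_left hcomp_id2 hcomp_assoc boundaries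
  by (auto simp: hom1_def hom2_def)

lemma hcomp_id2_merge:
  "\<alpha> \<in> Two K \<Longrightarrow> g \<in> One K \<Longrightarrow> h \<in> One K \<Longrightarrow> src K g = trg K (dom2 K \<alpha>) \<Longrightarrow> src K h = trg K g
    \<Longrightarrow> h \<rhd> (g \<rhd> \<alpha>) = (h \<odot> g) \<rhd> \<alpha>"
  by (metis hcomp_laws(3,4) id2_boundary)

lemmas cell_simps = boundaries id1_boundary comp1_boundary comp1_laws id2_boundary
  vcomp_boundary vcomp_laws hcomp_boundary hcomp_laws hcomp_id2_merge src_Ob trg_Ob

lemma interchange':
  assumes "\<alpha> \<in> Two K" "\<alpha>' \<in> Two K" "\<beta> \<in> Two K" "\<beta>' \<in> Two K" "dom2 K \<alpha>' = cod2 K \<alpha>"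
    "dom2 K \<beta>' = cod2 K \<beta>" "src K (dom2 K \<beta>) = trg K (dom2 K \<alpha>)"
  shows "(\<beta>' \<star> \<alpha>') \<cdot> (\<beta> \<star> \<alpha>) = (\<beta>' \<cdot> \<beta>) \<star> (\<alpha>' \<cdot> \<alpha>)"
  by (rule interchange[symmetric]) (use assms boundaries in \<open>auto simp: hom1_def hom2_def\<close>)

lemma whisker_left_vcomp:
  "\<alpha> \<in> Two K \<Longrightarrow> \<beta> \<in> Two K \<Longrightarrow> dom2 K \<beta> = cod2 K \<alpha> \<Longrightarrow> g \<in> One K \<Longrightarrow> src K g = trg K (dom2 K \<alpha>)
    \<Longrightarrow> g \<rhd> (\<beta> \<cdot> \<alpha>) = (g \<rhd> \<beta>) \<cdot> (g \<rhd> \<alpha>)"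
  by (simp add: interchange' cell_simps)

lemma whisker_right_vcomp:
  "\<alpha> \<in> Two K \<Longrightarrow> \<beta> \<in> Two K \<Longrightarrow> dom2 K \<beta> = cod2 K \<alpha> \<Longrightarrow> g \<in> One K \<Longrightarrow> trg K g = src K (dom2 K \<alpha>)
    \<Longrightarrow> (\<beta> \<cdot> \<alpha>) \<lhd> g = (\<beta> \<lhd> g) \<cdot> (\<alpha> \<lhd> g)"
  by (simp add: interchange' cell_simps)

lemma exchange:
  assumes "\<alpha> \<in> hom2 K f f'" "\<beta> \<in> hom2 K g g'" "src K g = trg K f"
  shows "(\<beta> \<lhd> f') \<cdot> (g \<rhd> \<alpha>) = \<beta> \<star> \<alpha>" "(g' \<rhd> \<alpha>) \<cdot> (\<beta> \<lhd> f) = \<beta> \<star> \<alpha>"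
  using assms boundaries by (auto simp: hom2_def interchange' cell_simps)

lemma right_extension_eqI:
  assumes "right_extension K g k r \<epsilon>" "\<chi> \<in> hom2 K r' r" "\<chi>' \<in> hom2 K r' r"
    and eq: "\<epsilon> \<cdot> (\<chi> \<lhd> g) = \<epsilon> \<cdot> (\<chi>' \<lhd> g)"
  shows "\<chi> = \<chi>'"
proof -
  have r': "r' \<in> hom1 K (trg K g) (trg K k)"
    using assms boundaries[of \<chi>] by (auto simp: right_extension_def hom1_def hom2_def)
  have "\<epsilon> \<cdot> (\<chi> \<lhd> g) \<in> hom2 K (r' \<odot> g) k"
    using assms boundaries[of \<chi>]
    by (auto simp: right_extension_def hom1_def hom2_def cell_simps)
  then show ?thesis
    using assms(1) r' assms(2,3) eq unfolding right_extension_def by metis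
qed

lemma right_extension_ex1:
  assumes "right_extension K g k r \<epsilon>" "r' \<in> hom1 K (trg K g) (trg K k)" "\<alpha> \<in> hom2 K (r' \<odot> g) k"
  shows "\<exists>!\<chi>. \<chi> \<in> hom2 K r' r \<and> \<epsilon> \<cdot> (\<chi> \<lhd> g) = \<alpha>"
  using assms by (simp add: right_extension_def)

lemma pushforward_ex1:
  assumes g: "g \<in> hom1 K x y" and t: "monad K x t"
    and ext: "right_extension K g (g \<odot> under t) r \<epsilon>"
  shows "\<exists>!p. under p = r \<and> pushforward K g t p \<epsilon>"
proof -
  let ?t = "under t"
  have ob: "x \<in> Ob K" "y \<in> Ob K"
    and g1: "g \<in> One K" "src K g = x" "trg K g = y"
    and t1: "?t \<in> One K" "src K ?t = x" "trg K ?t = x"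
    and e: "eta t \<in> Two K" "dom2 K (eta t) = id1 K x" "cod2 K (eta t) = ?t"
    and m: "mu t \<in> Two K" "dom2 K (mu t) = ?t \<odot> ?t" "cod2 K (mu t) = ?t"
    and tm: "mu t \<cdot> (eta t \<lhd> ?t) = id2 K ?t" "mu t \<cdot> (?t \<rhd> eta t) = id2 K ?t"
      "mu t \<cdot> (mu t \<lhd> ?t) = mu t \<cdot> (?t \<rhd> mu t)"
    using g t src_Ob trg_Ob by (auto simp: monad_def hom1_def hom2_def)
  have r1: "r \<in> One K" "src K r = y" "trg K r = y"
    and E: "\<epsilon> \<in> Two K" "dom2 K \<epsilon> = r \<odot> g" "cod2 K \<epsilon> = g \<odot> ?t"
    using ext g1 t1 by (auto simp: right_extension_def hom1_def hom2_def cell_simps)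
  note cs = ob g1 t1 e m r1 E cell_simps
  let ?M = "(g \<rhd> mu t) \<cdot> (\<epsilon> \<lhd> ?t) \<cdot> (r \<rhd> \<epsilon>)"
  have "g \<rhd> eta t \<in> hom2 K (id1 K y \<odot> g) (g \<odot> ?t)"
    by (simp add: hom2_def cs)
  then have ex_eta: "\<exists>!\<chi>. \<chi> \<in> hom2 K (id1 K y) r \<and> \<epsilon> \<cdot> (\<chi> \<lhd> g) = g \<rhd> eta t"
    by (intro right_extension_ex1[OF ext]) (simp_all add: hom1_def cs)
  have "?M \<in> hom2 K ((r \<odot> r) \<odot> g) (g \<odot> ?t)"
    by (simp add: hom2_def cs)
  then have ex_mu: "\<exists>!\<chi>. \<chi> \<in> hom2 K (r \<odot> r) r \<and> \<epsilon> \<cdot> (\<chi> \<lhd> g) = ?M"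
    by (intro right_extension_ex1[OF ext]) (simp_all add: hom1_def cs)
  obtain u where u: "u \<in> Two K" "dom2 K u = id1 K y" "cod2 K u = r"
    and ug: "\<epsilon> \<cdot> (u \<lhd> g) = g \<rhd> eta t"
    using ex_eta by (auto simp: hom2_def)
  obtain n where n: "n \<in> Two K" "dom2 K n = r \<odot> r" "cod2 K n = r"
    and ng: "\<epsilon> \<cdot> (n \<lhd> g) = ?M"
    using ex_mu by (auto simp: hom2_def)
  note cs = cs u n
  have ng': "\<epsilon> \<cdot> (n \<lhd> g) \<cdot> \<beta> = (g \<rhd> mu t) \<cdot> (\<epsilon> \<lhd> ?t) \<cdot> (r \<rhd> \<epsilon>) \<cdot> \<beta>"
    if "\<beta> \<in> Two K" "cod2 K \<beta> = r \<odot> r \<odot> g" for \<beta>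
  proof -
    have "(\<epsilon> \<cdot> (n \<lhd> g)) \<cdot> \<beta> = ?M \<cdot> \<beta>" by (simp only: ng)
    then show ?thesis using that by (simp add: cs)
  qed
  have left_unit: "n \<cdot> (u \<lhd> r) = id2 K r"
  proof (rule right_extension_eqI[OF ext])
    show "n \<cdot> (u \<lhd> r) \<in> hom2 K r r" "id2 K r \<in> hom2 K r r" by (simp_all add: hom2_def cs)
    have "\<epsilon> \<cdot> ((n \<cdot> (u \<lhd> r)) \<lhd> g) = \<epsilon> \<cdot> (n \<lhd> g) \<cdot> (u \<lhd> (r \<odot> g))"
      by (simp add: whisker_right_vcomp cs)
    also have "\<dots> = (g \<rhd> mu t) \<cdot> (\<epsilon> \<lhd> ?t) \<cdot> ((r \<rhd> \<epsilon>) \<cdot> (u \<lhd> (r \<odot> g)))"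
      by (simp add: ng' cs)
    also have "(r \<rhd> \<epsilon>) \<cdot> (u \<lhd> (r \<odot> g)) = (u \<lhd> (g \<odot> ?t)) \<cdot> \<epsilon>"
      using exchange[of \<epsilon> "r \<odot> g" "g \<odot> ?t" u "id1 K y" r] by (simp add: hom2_def cs)
    also have "(g \<rhd> mu t) \<cdot> (\<epsilon> \<lhd> ?t) \<cdot> (u \<lhd> (g \<odot> ?t)) \<cdot> \<epsilon> =
        (g \<rhd> mu t) \<cdot> ((\<epsilon> \<cdot> (u \<lhd> g)) \<lhd> ?t) \<cdot> \<epsilon>"
      by (simp add: whisker_right_vcomp cs)
    also have "\<dots> = (g \<rhd> (mu t \<cdot> (eta t \<lhd> ?t))) \<cdot> \<epsilon>"
      by (simp only: ug) (simp add: whisker_left_vcomp cs)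
    also have "\<dots> = \<epsilon>" by (simp only: tm) (simp add: cs)
    finally show "\<epsilon> \<cdot> ((n \<cdot> (u \<lhd> r)) \<lhd> g) = \<epsilon> \<cdot> (id2 K r \<lhd> g)" by (simp add: cs)
  qed
  have right_unit: "n \<cdot> (r \<rhd> u) = id2 K r"
  proof (rule right_extension_eqI[OF ext])
    show "n \<cdot> (r \<rhd> u) \<in> hom2 K r r" "id2 K r \<in> hom2 K r r" by (simp_all add: hom2_def cs)
    have "\<epsilon> \<cdot> ((n \<cdot> (r \<rhd> u)) \<lhd> g) = \<epsilon> \<cdot> (n \<lhd> g) \<cdot> (r \<rhd> (u \<lhd> g))"
      by (simp add: whisker_right_vcomp cs)
    also have "\<dots> = (g \<rhd> mu t) \<cdot> (\<epsilon> \<lhd> ?t) \<cdot> (r \<rhd> (\<epsilon> \<cdot> (u \<lhd> g)))"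
      by (simp add: ng' whisker_left_vcomp cs)
    also have "\<dots> = (g \<rhd> mu t) \<cdot> ((\<epsilon> \<lhd> ?t) \<cdot> ((r \<odot> g) \<rhd> eta t))"
      by (simp only: ug) (simp add: cs)
    also have "(\<epsilon> \<lhd> ?t) \<cdot> ((r \<odot> g) \<rhd> eta t) = ((g \<odot> ?t) \<rhd> eta t) \<cdot> \<epsilon>"
      using exchange[of "eta t" "id1 K x" ?t \<epsilon> "r \<odot> g" "g \<odot> ?t"] by (simp add: hom2_def cs)
    also have "(g \<rhd> mu t) \<cdot> ((g \<odot> ?t) \<rhd> eta t) \<cdot> \<epsilon> = (g \<rhd> (mu t \<cdot> (?t \<rhd> eta t))) \<cdot> \<epsilon>"
      by (simp add: whisker_left_vcomp cs)
    also have "\<dots> = \<epsilon>" by (simp only: tm) (simp add: cs)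
    finally show "\<epsilon> \<cdot> ((n \<cdot> (r \<rhd> u)) \<lhd> g) = \<epsilon> \<cdot> (id2 K r \<lhd> g)" by (simp add: cs)
  qed
  have assoc: "n \<cdot> (n \<lhd> r) = n \<cdot> (r \<rhd> n)"
  proof (rule right_extension_eqI[OF ext])
    show "n \<cdot> (n \<lhd> r) \<in> hom2 K (r \<odot> r \<odot> r) r" "n \<cdot> (r \<rhd> n) \<in> hom2 K (r \<odot> r \<odot> r) r"
      by (simp_all add: hom2_def cs)
    let ?R = "(\<epsilon> \<lhd> (?t \<odot> ?t)) \<cdot> (r \<rhd> (\<epsilon> \<lhd> ?t)) \<cdot> ((r \<odot> r) \<rhd> \<epsilon>)"
    have "\<epsilon> \<cdot> ((n \<cdot> (n \<lhd> r)) \<lhd> g) = \<epsilon> \<cdot> (n \<lhd> g) \<cdot> (n \<lhd> (r \<odot> g))"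
      by (simp add: whisker_right_vcomp cs)
    also have "\<dots> = (g \<rhd> mu t) \<cdot> (\<epsilon> \<lhd> ?t) \<cdot> ((r \<rhd> \<epsilon>) \<cdot> (n \<lhd> (r \<odot> g)))"
      by (simp add: ng' cs)
    also have "(r \<rhd> \<epsilon>) \<cdot> (n \<lhd> (r \<odot> g)) = (n \<lhd> (g \<odot> ?t)) \<cdot> ((r \<odot> r) \<rhd> \<epsilon>)"
      using exchange[of \<epsilon> "r \<odot> g" "g \<odot> ?t" n "r \<odot> r" r] by (simp add: hom2_def cs)
    also have "(g \<rhd> mu t) \<cdot> (\<epsilon> \<lhd> ?t) \<cdot> (n \<lhd> (g \<odot> ?t)) \<cdot> ((r \<odot> r) \<rhd> \<epsilon>) =
        (g \<rhd> mu t) \<cdot> ((\<epsilon> \<cdot> (n \<lhd> g)) \<lhd> ?t) \<cdot> ((r \<odot> r) \<rhd> \<epsilon>)"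
      by (simp add: whisker_right_vcomp cs)
    also have "\<dots> = (g \<rhd> (mu t \<cdot> (mu t \<lhd> ?t))) \<cdot> ?R"
      by (simp only: ng) (simp add: whisker_left_vcomp whisker_right_vcomp cs)
    also have "\<dots> = (g \<rhd> (mu t \<cdot> (?t \<rhd> mu t))) \<cdot> ?R" by (simp only: tm)
    also have "\<dots> = (g \<rhd> mu t) \<cdot> (((g \<odot> ?t) \<rhd> mu t) \<cdot> (\<epsilon> \<lhd> (?t \<odot> ?t))) \<cdot>
        (r \<rhd> (\<epsilon> \<lhd> ?t)) \<cdot> ((r \<odot> r) \<rhd> \<epsilon>)"
      by (simp add: whisker_left_vcomp cs)
    also have "((g \<odot> ?t) \<rhd> mu t) \<cdot> (\<epsilon> \<lhd> (?t \<odot> ?t)) = (\<epsilon> \<lhd> ?t) \<cdot> ((r \<odot> g) \<rhd> mu t)"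
      using exchange[of "mu t" "?t \<odot> ?t" ?t \<epsilon> "r \<odot> g" "g \<odot> ?t"] by (simp add: hom2_def cs)
    also have "(g \<rhd> mu t) \<cdot> ((\<epsilon> \<lhd> ?t) \<cdot> ((r \<odot> g) \<rhd> mu t)) \<cdot>
        (r \<rhd> (\<epsilon> \<lhd> ?t)) \<cdot> ((r \<odot> r) \<rhd> \<epsilon>) = (g \<rhd> mu t) \<cdot> (\<epsilon> \<lhd> ?t) \<cdot> (r \<rhd> ?M)"
      by (simp add: whisker_left_vcomp cs)
    also have "\<dots> = (g \<rhd> mu t) \<cdot> (\<epsilon> \<lhd> ?t) \<cdot> (r \<rhd> (\<epsilon> \<cdot> (n \<lhd> g)))" by (simp only: ng)
    also have "\<dots> = \<epsilon> \<cdot> (n \<lhd> g) \<cdot> (r \<rhd> (n \<lhd> g))"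
      by (simp add: ng' whisker_left_vcomp cs)
    also have "\<dots> = \<epsilon> \<cdot> ((n \<cdot> (r \<rhd> n)) \<lhd> g)"
      by (simp add: whisker_right_vcomp cs)
    finally show "\<epsilon> \<cdot> ((n \<cdot> (n \<lhd> r)) \<lhd> g) = \<epsilon> \<cdot> ((n \<cdot> (r \<rhd> n)) \<lhd> g)" .
  qed
  show ?thesis
  proof (rule ex1I[of _ "\<lparr>under = r, eta = u, mu = n\<rparr>"])
    show "under \<lparr>under = r, eta = u, mu = n\<rparr> = r \<and>
        pushforward K g t \<lparr>under = r, eta = u, mu = n\<rparr> \<epsilon>"
      using ext left_unit right_unit assoc ug ng
      by (simp add: pushforward_def monad_def hom1_def hom2_def cs)
  next
    fix p assume p: "under p = r \<and> pushforward K g t p \<epsilon>"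
    then have "eta p \<in> hom2 K (id1 K y) r \<and> \<epsilon> \<cdot> (eta p \<lhd> g) = g \<rhd> eta t"
      "mu p \<in> hom2 K (r \<odot> r) r \<and> \<epsilon> \<cdot> (mu p \<lhd> g) = ?M"
      using g1 unfolding pushforward_def monad_def by auto
    moreover have "u \<in> hom2 K (id1 K y) r \<and> \<epsilon> \<cdot> (u \<lhd> g) = g \<rhd> eta t"
      "n \<in> hom2 K (r \<odot> r) r \<and> \<epsilon> \<cdot> (n \<lhd> g) = ?M"
      using u n ug ng by (simp_all add: hom2_def)
    ultimately have "eta p = u" "mu p = n"
      using ex_eta ex_mu by blast+
    with p show "p = \<lparr>under = r, eta = u, mu = n\<rparr>" by simp
  qed
qed

lemma pushforward_map_ex1:
  assumes p: "pushforward K g t p \<epsilon>" and p': "pushforward K g t' p' \<epsilon>'"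
    and g: "g \<in> hom1 K x y" and t: "monad K x t" and t': "monad K x t'"
    and \<theta>: "\<theta> \<in> Mnd K t t'"
  shows "\<exists>!\<chi>. \<chi> \<in> hom2 K (under p) (under p') \<and> \<epsilon>' \<cdot> (\<chi> \<lhd> g) = (g \<rhd> \<theta>) \<cdot> \<epsilon>"
proof (rule right_extension_ex1)
  show "right_extension K g (g \<odot> under t') (under p') \<epsilon>'"
    using p' by (simp add: pushforward_def)
  show "under p \<in> hom1 K (trg K g) (trg K (g \<odot> under t'))"
    using p g t' by (auto simp: pushforward_def monad_def hom1_def cell_simps)
  show "(g \<rhd> \<theta>) \<cdot> \<epsilon> \<in> hom2 K (under p \<odot> g) (g \<odot> under t')"
    using p g t \<theta>
    by (auto simp: pushforward_def right_extension_def Mnd_def monad_def hom1_def hom2_def cell_simps)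
qed

lemma pushforward_map_Mnd:
  assumes p: "pushforward K g t p \<epsilon>" and p': "pushforward K g t' p' \<epsilon>'"
    and g: "g \<in> hom1 K x y" and t: "monad K x t" and t': "monad K x t'"
    and \<theta>: "\<theta> \<in> Mnd K t t'"
  shows "pushforward_map K g p \<epsilon> p' \<epsilon>' \<theta> \<in> Mnd K p p'"
proof -
  let ?t = "under t" and ?t' = "under t'" and ?r = "under p" and ?r' = "under p'"
  define \<chi> where "\<chi> = pushforward_map K g p \<epsilon> p' \<epsilon>' \<theta>"
  have \<chi>: "\<chi> \<in> hom2 K ?r ?r'" and \<chi>g: "\<epsilon>' \<cdot> (\<chi> \<lhd> g) = (g \<rhd> \<theta>) \<cdot> \<epsilon>"
    using theI'[OF pushforward_map_ex1[OF assms]] by (auto simp: \<chi>_def pushforward_map_def)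
  have ext': "right_extension K g (g \<odot> ?t') ?r' \<epsilon>'"
    using p' by (simp add: pushforward_def)
  have p_eq: "\<epsilon> \<cdot> (eta p \<lhd> g) = g \<rhd> eta t"
      "\<epsilon> \<cdot> (mu p \<lhd> g) = (g \<rhd> mu t) \<cdot> (\<epsilon> \<lhd> ?t) \<cdot> (?r \<rhd> \<epsilon>)"
    and p'_eq: "\<epsilon>' \<cdot> (eta p' \<lhd> g) = g \<rhd> eta t'"
      "\<epsilon>' \<cdot> (mu p' \<lhd> g) = (g \<rhd> mu t') \<cdot> (\<epsilon>' \<lhd> ?t') \<cdot> (?r' \<rhd> \<epsilon>')"
    and \<theta>_eq: "\<theta> \<cdot> eta t = eta t'" "\<theta> \<cdot> mu t = mu t' \<cdot> (\<theta> \<star> \<theta>)"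
    using p p' \<theta> by (auto simp: pushforward_def Mnd_def)
  have ob: "x \<in> Ob K" "y \<in> Ob K"
    and g1: "g \<in> One K" "src K g = x" "trg K g = y"
    and t1: "?t \<in> One K" "src K ?t = x" "trg K ?t = x"
      "?t' \<in> One K" "src K ?t' = x" "trg K ?t' = x"
    and e: "eta t \<in> Two K" "dom2 K (eta t) = id1 K x" "cod2 K (eta t) = ?t"
      "eta t' \<in> Two K" "dom2 K (eta t') = id1 K x" "cod2 K (eta t') = ?t'"
    and m: "mu t \<in> Two K" "dom2 K (mu t) = ?t \<odot> ?t" "cod2 K (mu t) = ?t"
      "mu t' \<in> Two K" "dom2 K (mu t') = ?t' \<odot> ?t'" "cod2 K (mu t') = ?t'"
    and th: "\<theta> \<in> Two K" "dom2 K \<theta> = ?t" "cod2 K \<theta> = ?t'"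
    and ch: "\<chi> \<in> Two K" "dom2 K \<chi> = ?r" "cod2 K \<chi> = ?r'"
    using g t t' \<theta> \<chi> src_Ob trg_Ob by (auto simp: monad_def Mnd_def hom1_def hom2_def)
  have r1: "?r \<in> One K" "src K ?r = y" "trg K ?r = y"
      "?r' \<in> One K" "src K ?r' = y" "trg K ?r' = y"
    and u: "eta p \<in> Two K" "dom2 K (eta p) = id1 K y" "cod2 K (eta p) = ?r"
      "eta p' \<in> Two K" "dom2 K (eta p') = id1 K y" "cod2 K (eta p') = ?r'"
    and n: "mu p \<in> Two K" "dom2 K (mu p) = ?r \<odot> ?r" "cod2 K (mu p) = ?r"
      "mu p' \<in> Two K" "dom2 K (mu p') = ?r' \<odot> ?r'" "cod2 K (mu p') = ?r'"
    and E: "\<epsilon> \<in> Two K" "dom2 K \<epsilon> = ?r \<odot> g" "cod2 K \<epsilon> = g \<odot> ?t"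
      "\<epsilon>' \<in> Two K" "dom2 K \<epsilon>' = ?r' \<odot> g" "cod2 K \<epsilon>' = g \<odot> ?t'"
    using p p' g1 by (auto simp: pushforward_def right_extension_def monad_def hom1_def hom2_def)
  note cs = ob g1 t1 e m th ch r1 u n E cell_simps
  have \<chi>g': "\<epsilon>' \<cdot> (\<chi> \<lhd> g) \<cdot> \<beta> = (g \<rhd> \<theta>) \<cdot> \<epsilon> \<cdot> \<beta>" if "\<beta> \<in> Two K" "cod2 K \<beta> = ?r \<odot> g" for \<beta>
  proof -
    have "(\<epsilon>' \<cdot> (\<chi> \<lhd> g)) \<cdot> \<beta> = ((g \<rhd> \<theta>) \<cdot> \<epsilon>) \<cdot> \<beta>" by (simp only: \<chi>g)
    then show ?thesis using that by (simp add: cs)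
  qed
  have unit: "\<chi> \<cdot> eta p = eta p'"
  proof (rule right_extension_eqI[OF ext'])
    show "\<chi> \<cdot> eta p \<in> hom2 K (id1 K y) ?r'" "eta p' \<in> hom2 K (id1 K y) ?r'"
      by (simp_all add: hom2_def cs)
    have "\<epsilon>' \<cdot> ((\<chi> \<cdot> eta p) \<lhd> g) = (g \<rhd> \<theta>) \<cdot> \<epsilon> \<cdot> (eta p \<lhd> g)"
      by (simp add: whisker_right_vcomp \<chi>g' cs)
    also have "\<dots> = g \<rhd> (\<theta> \<cdot> eta t)" by (simp only: p_eq) (simp add: whisker_left_vcomp cs)
    finally show "\<epsilon>' \<cdot> ((\<chi> \<cdot> eta p) \<lhd> g) = \<epsilon>' \<cdot> (eta p' \<lhd> g)" by (simp only: \<theta>_eq p'_eq)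
  qed
  have mult: "\<chi> \<cdot> mu p = mu p' \<cdot> (\<chi> \<star> \<chi>)"
  proof (rule right_extension_eqI[OF ext'])
    show "\<chi> \<cdot> mu p \<in> hom2 K (?r \<odot> ?r) ?r'" "mu p' \<cdot> (\<chi> \<star> \<chi>) \<in> hom2 K (?r \<odot> ?r) ?r'"
      by (simp_all add: hom2_def cs)
    have "\<epsilon>' \<cdot> ((mu p' \<cdot> (\<chi> \<star> \<chi>)) \<lhd> g) = (\<epsilon>' \<cdot> (mu p' \<lhd> g)) \<cdot> (\<chi> \<star> (\<chi> \<lhd> g))"
      by (simp add: whisker_right_vcomp cs)
    also have "\<dots> = (g \<rhd> mu t') \<cdot> (\<epsilon>' \<lhd> ?t') \<cdot> ((?r' \<rhd> \<epsilon>') \<cdot> (\<chi> \<star> (\<chi> \<lhd> g)))"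
      by (simp only: p'_eq) (simp add: cs)
    also have "(?r' \<rhd> \<epsilon>') \<cdot> (\<chi> \<star> (\<chi> \<lhd> g)) = \<chi> \<star> ((g \<rhd> \<theta>) \<cdot> \<epsilon>)"
      by (subst interchange') (simp_all add: \<chi>g cs)
    also have "\<chi> \<star> ((g \<rhd> \<theta>) \<cdot> \<epsilon>) = (\<chi> \<star> (g \<rhd> \<theta>)) \<cdot> (?r \<rhd> \<epsilon>)"
      by (subst interchange') (simp_all add: cs)
    also have "(\<epsilon>' \<lhd> ?t') \<cdot> (\<chi> \<star> (g \<rhd> \<theta>)) \<cdot> (?r \<rhd> \<epsilon>) =
        ((\<epsilon>' \<lhd> ?t') \<cdot> ((\<chi> \<lhd> g) \<star> \<theta>)) \<cdot> (?r \<rhd> \<epsilon>)"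
      by (simp add: cs)
    also have "(\<epsilon>' \<lhd> ?t') \<cdot> ((\<chi> \<lhd> g) \<star> \<theta>) = ((g \<rhd> \<theta>) \<cdot> \<epsilon>) \<star> \<theta>"
      by (subst interchange') (simp_all add: \<chi>g cs)
    also have "((g \<rhd> \<theta>) \<cdot> \<epsilon>) \<star> \<theta> = ((g \<rhd> \<theta>) \<star> \<theta>) \<cdot> (\<epsilon> \<lhd> ?t)"
      by (subst interchange') (simp_all add: cs)
    also have "(g \<rhd> mu t') \<cdot> (((g \<rhd> \<theta>) \<star> \<theta>) \<cdot> (\<epsilon> \<lhd> ?t)) \<cdot> (?r \<rhd> \<epsilon>) =
        (g \<rhd> (mu t' \<cdot> (\<theta> \<star> \<theta>))) \<cdot> (\<epsilon> \<lhd> ?t) \<cdot> (?r \<rhd> \<epsilon>)"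
      by (simp add: whisker_left_vcomp cs)
    also have "\<dots> = (g \<rhd> (\<theta> \<cdot> mu t)) \<cdot> (\<epsilon> \<lhd> ?t) \<cdot> (?r \<rhd> \<epsilon>)"
      by (simp only: \<theta>_eq)
    also have "\<dots> = (g \<rhd> \<theta>) \<cdot> \<epsilon> \<cdot> (mu p \<lhd> g)"
      by (simp only: p_eq) (simp add: whisker_left_vcomp cs)
    also have "\<dots> = \<epsilon>' \<cdot> ((\<chi> \<cdot> mu p) \<lhd> g)"
      by (simp add: whisker_right_vcomp \<chi>g' cs)
    finally show "\<epsilon>' \<cdot> ((\<chi> \<cdot> mu p) \<lhd> g) = \<epsilon>' \<cdot> ((mu p' \<cdot> (\<chi> \<star> \<chi>)) \<lhd> g)" by simp
  qed
  show ?thesis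
    using \<chi> unit mult by (simp add: Mnd_def flip: \<chi>_def)
qed

lemma colax_pre_Colax:
  assumes g: "g \<in> hom1 K x y" and t: "monad K x t" and t': "monad K x t'" and s: "monad K y s"
    and \<theta>: "\<theta> \<in> Mnd K t' t" and c: "c \<in> Colax K g t s"
  shows "colax_pre K \<theta> c \<in> Colax K g t' s"
proof -
  let ?t = "under t" and ?t' = "under t'" and ?s = "under s"
  obtain \<psi> where c_eq: "c = (g, \<psi>)" and \<psi>: "\<psi> \<in> hom2 K (g \<odot> ?t) (?s \<odot> g)"
    and \<psi>_eta: "\<psi> \<cdot> (g \<rhd> eta t) = eta s \<lhd> g"
    and \<psi>_mu: "\<psi> \<cdot> (g \<rhd> mu t) = (mu s \<lhd> g) \<cdot> (?s \<rhd> \<psi>) \<cdot> (\<psi> \<lhd> ?t)"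
    using c by (auto simp: Colax_def)
  have \<theta>_eq: "\<theta> \<cdot> eta t' = eta t" "\<theta> \<cdot> mu t' = mu t \<cdot> (\<theta> \<star> \<theta>)"
    using \<theta> by (auto simp: Mnd_def)
  have ob: "x \<in> Ob K" "y \<in> Ob K"
    and g1: "g \<in> One K" "src K g = x" "trg K g = y"
    and t1: "?t \<in> One K" "src K ?t = x" "trg K ?t = x" "?t' \<in> One K" "src K ?t' = x" "trg K ?t' = x"
      "?s \<in> One K" "src K ?s = y" "trg K ?s = y"
    and e: "eta t \<in> Two K" "dom2 K (eta t) = id1 K x" "cod2 K (eta t) = ?t"
      "eta t' \<in> Two K" "dom2 K (eta t') = id1 K x" "cod2 K (eta t') = ?t'"
      "eta s \<in> Two K" "dom2 K (eta s) = id1 K y" "cod2 K (eta s) = ?s"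
    and m: "mu t \<in> Two K" "dom2 K (mu t) = ?t \<odot> ?t" "cod2 K (mu t) = ?t"
      "mu t' \<in> Two K" "dom2 K (mu t') = ?t' \<odot> ?t'" "cod2 K (mu t') = ?t'"
      "mu s \<in> Two K" "dom2 K (mu s) = ?s \<odot> ?s" "cod2 K (mu s) = ?s"
    and th: "\<theta> \<in> Two K" "dom2 K \<theta> = ?t'" "cod2 K \<theta> = ?t"
    and ps: "\<psi> \<in> Two K" "dom2 K \<psi> = g \<odot> ?t" "cod2 K \<psi> = ?s \<odot> g"
    using g t t' s \<theta> \<psi> src_Ob trg_Ob by (auto simp: monad_def Mnd_def hom1_def hom2_def)
  note cs = ob g1 t1 e m th ps cell_simps
  have "(\<psi> \<cdot> (g \<rhd> \<theta>)) \<cdot> (g \<rhd> eta t') = \<psi> \<cdot> (g \<rhd> (\<theta> \<cdot> eta t'))"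
    by (simp add: whisker_left_vcomp cs)
  then have unit: "(\<psi> \<cdot> (g \<rhd> \<theta>)) \<cdot> (g \<rhd> eta t') = eta s \<lhd> g"
    by (simp only: \<theta>_eq \<psi>_eta)
  have "(\<psi> \<cdot> (g \<rhd> \<theta>)) \<cdot> (g \<rhd> mu t') = \<psi> \<cdot> (g \<rhd> (\<theta> \<cdot> mu t'))"
    by (simp add: whisker_left_vcomp cs)
  also have "\<dots> = (\<psi> \<cdot> (g \<rhd> mu t)) \<cdot> (g \<rhd> (\<theta> \<star> \<theta>))"
    by (simp only: \<theta>_eq) (simp add: whisker_left_vcomp cs)
  also have "\<dots> = (mu s \<lhd> g) \<cdot> (?s \<rhd> \<psi>) \<cdot> ((\<psi> \<lhd> ?t) \<cdot> ((g \<rhd> \<theta>) \<star> \<theta>))"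
    by (simp only: \<psi>_mu) (simp add: cs)
  also have "(\<psi> \<lhd> ?t) \<cdot> ((g \<rhd> \<theta>) \<star> \<theta>) = (\<psi> \<cdot> (g \<rhd> \<theta>)) \<star> \<theta>"
    by (subst interchange') (simp_all add: cs)
  also have "\<dots> = ((?s \<odot> g) \<rhd> \<theta>) \<cdot> ((\<psi> \<cdot> (g \<rhd> \<theta>)) \<lhd> ?t')"
    by (subst interchange') (simp_all add: cs)
  also have "(mu s \<lhd> g) \<cdot> (?s \<rhd> \<psi>) \<cdot> ((?s \<odot> g) \<rhd> \<theta>) \<cdot> ((\<psi> \<cdot> (g \<rhd> \<theta>)) \<lhd> ?t') =
      (mu s \<lhd> g) \<cdot> (?s \<rhd> (\<psi> \<cdot> (g \<rhd> \<theta>))) \<cdot> ((\<psi> \<cdot> (g \<rhd> \<theta>)) \<lhd> ?t')"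
    by (simp add: whisker_left_vcomp cs)
  finally show ?thesis
    using unit by (simp add: c_eq colax_pre_def Colax_def hom2_def cs)
qed

lemma colax_post_Colax:
  assumes g: "g \<in> hom1 K x y" and t: "monad K x t" and s: "monad K y s" and s': "monad K y s'"
    and \<theta>: "\<theta> \<in> Mnd K s s'" and c: "c \<in> Colax K g t s"
  shows "colax_post K \<theta> c \<in> Colax K g t s'"
proof -
  let ?t = "under t" and ?s' = "under s'" and ?s = "under s"
  obtain \<psi> where c_eq: "c = (g, \<psi>)" and \<psi>: "\<psi> \<in> hom2 K (g \<odot> ?t) (?s \<odot> g)"
    and \<psi>_eta: "\<psi> \<cdot> (g \<rhd> eta t) = eta s \<lhd> g"
    and \<psi>_mu: "\<psi> \<cdot> (g \<rhd> mu t) = (mu s \<lhd> g) \<cdot> (?s \<rhd> \<psi>) \<cdot> (\<psi> \<lhd> ?t)"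
    using c by (auto simp: Colax_def)
  have \<theta>_eq: "\<theta> \<cdot> eta s = eta s'" "\<theta> \<cdot> mu s = mu s' \<cdot> (\<theta> \<star> \<theta>)"
    using \<theta> by (auto simp: Mnd_def)
  have ob: "x \<in> Ob K" "y \<in> Ob K"
    and g1: "g \<in> One K" "src K g = x" "trg K g = y"
    and t1: "?t \<in> One K" "src K ?t = x" "trg K ?t = x" "?s' \<in> One K" "src K ?s' = y" "trg K ?s' = y"
      "?s \<in> One K" "src K ?s = y" "trg K ?s = y"
    and e: "eta t \<in> Two K" "dom2 K (eta t) = id1 K x" "cod2 K (eta t) = ?t"
      "eta s' \<in> Two K" "dom2 K (eta s') = id1 K y" "cod2 K (eta s') = ?s'"
      "eta s \<in> Two K" "dom2 K (eta s) = id1 K y" "cod2 K (eta s) = ?s"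
    and m: "mu t \<in> Two K" "dom2 K (mu t) = ?t \<odot> ?t" "cod2 K (mu t) = ?t"
      "mu s' \<in> Two K" "dom2 K (mu s') = ?s' \<odot> ?s'" "cod2 K (mu s') = ?s'"
      "mu s \<in> Two K" "dom2 K (mu s) = ?s \<odot> ?s" "cod2 K (mu s) = ?s"
    and th: "\<theta> \<in> Two K" "dom2 K \<theta> = ?s" "cod2 K \<theta> = ?s'"
    and ps: "\<psi> \<in> Two K" "dom2 K \<psi> = g \<odot> ?t" "cod2 K \<psi> = ?s \<odot> g"
    using g t s' s \<theta> \<psi> src_Ob trg_Ob by (auto simp: monad_def Mnd_def hom1_def hom2_def)
  note cs = ob g1 t1 e m th ps cell_simps
  have "((\<theta> \<lhd> g) \<cdot> \<psi>) \<cdot> (g \<rhd> eta t) = (\<theta> \<lhd> g) \<cdot> (\<psi> \<cdot> (g \<rhd> eta t))"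
    by (simp add: cs)
  also have "\<dots> = (\<theta> \<cdot> eta s) \<lhd> g"
    by (simp only: \<psi>_eta) (simp add: whisker_right_vcomp cs)
  finally have unit: "((\<theta> \<lhd> g) \<cdot> \<psi>) \<cdot> (g \<rhd> eta t) = eta s' \<lhd> g"
    by (simp only: \<theta>_eq)
  have "((\<theta> \<lhd> g) \<cdot> \<psi>) \<cdot> (g \<rhd> mu t) = (\<theta> \<lhd> g) \<cdot> (\<psi> \<cdot> (g \<rhd> mu t))"
    by (simp add: cs)
  also have "\<dots> = ((\<theta> \<cdot> mu s) \<lhd> g) \<cdot> (?s \<rhd> \<psi>) \<cdot> (\<psi> \<lhd> ?t)"
    by (simp only: \<psi>_mu) (simp add: whisker_right_vcomp cs)
  also have "\<dots> = (mu s' \<lhd> g) \<cdot> ((\<theta> \<star> (\<theta> \<lhd> g)) \<cdot> (?s \<rhd> \<psi>)) \<cdot> (\<psi> \<lhd> ?t)"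
    by (simp only: \<theta>_eq) (simp add: whisker_right_vcomp cs)
  also have "(\<theta> \<star> (\<theta> \<lhd> g)) \<cdot> (?s \<rhd> \<psi>) = \<theta> \<star> ((\<theta> \<lhd> g) \<cdot> \<psi>)"
    by (subst interchange') (simp_all add: cs)
  also have "\<dots> = (?s' \<rhd> ((\<theta> \<lhd> g) \<cdot> \<psi>)) \<cdot> (\<theta> \<lhd> (g \<odot> ?t))"
    by (subst interchange') (simp_all add: cs)
  also have "(mu s' \<lhd> g) \<cdot> ((?s' \<rhd> ((\<theta> \<lhd> g) \<cdot> \<psi>)) \<cdot> (\<theta> \<lhd> (g \<odot> ?t))) \<cdot> (\<psi> \<lhd> ?t) =
      (mu s' \<lhd> g) \<cdot> (?s' \<rhd> ((\<theta> \<lhd> g) \<cdot> \<psi>)) \<cdot> (((\<theta> \<lhd> g) \<cdot> \<psi>) \<lhd> ?t)"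
    by (simp add: whisker_left_vcomp whisker_right_vcomp cs)
  finally show ?thesis
    using unit by (simp add: c_eq colax_post_def Colax_def hom2_def cs)
qed

end

end

theory Submission
  imports Defs
begin

text \<open>
  As \<open>s\<close> is \<open>g\<close>-determined, 2-cells into \<open>s\<close> are constructed and compared after whiskering
  with \<open>g\<close>.  There the 2-cell extending \<open>\<psi>\<close> becomes \<open>\<psi> \<cdot> \<epsilon>\<close>, and \<open>\<epsilon>\<close> turns the unit and
  multiplication of the pushforward into those of \<open>t\<close>.  For monicity, \<open>\<psi> \<cdot> \<epsilon>\<close> is cancelled
  in two steps: \<open>\<psi>\<close> because it is monic, \<open>\<epsilon>\<close> because it is universal.
\<close>

context two_category
begin

text \<open>The counit here is an identity, so it drops out of the universal property, which then
  says that whiskering with \<open>g\<close> is a bijection from 2-cells \<open>r\<close> to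
  \<open>h\<close> onto 2-cells \<open>r \<odot> g\<close> to \<open>h \<odot> g\<close>.\<close>

lemma determined_ex1:
  assumes d: "determined K g h" and r: "r \<in> hom1 K (trg K g) (trg K h)"
    and \<alpha>: "\<alpha> \<in> hom2 K (r \<odot> g) (h \<odot> g)"
  shows "\<exists>!\<chi>. \<chi> \<in> hom2 K r h \<and> \<chi> \<lhd> g = \<alpha>"
proof -
  \<comment> \<open>The identity law is available only for composable cells, hence the restriction
    to \<open>\<chi>\<close> of the right boundary; this is harmless, since the unique existence
    quantifies over just these.\<close>
  have "id2 K (h \<odot> g) \<cdot> (\<chi> \<lhd> g) = \<chi> \<lhd> g" if "\<chi> \<in> hom2 K r h" for \<chi>
    using that d r by (auto simp: determined_def hom1_def hom2_def cell_simps)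
  moreover have "\<exists>!\<chi>. \<chi> \<in> hom2 K r h \<and> id2 K (h \<odot> g) \<cdot> (\<chi> \<lhd> g) = \<alpha>"
    using d r \<alpha> by (intro right_extension_ex1) (auto simp: determined_def hom1_def cell_simps)
  ultimately show ?thesis by (metis (no_types, lifting))
qed

lemma determined_eqI:
  assumes d: "determined K g h" and "\<chi> \<in> hom2 K r h" "\<chi>' \<in> hom2 K r h"
    and "\<chi> \<lhd> g = \<chi>' \<lhd> g"
  shows "\<chi> = \<chi>'"
proof (rule right_extension_eqI)
  show "right_extension K g (h \<odot> g) h (id2 K (h \<odot> g))"
    using d by (simp add: determined_def)
  show "id2 K (h \<odot> g) \<cdot> (\<chi> \<lhd> g) = id2 K (h \<odot> g) \<cdot> (\<chi>' \<lhd> g)"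
    by (simp only: assms(4))
qed fact+

text \<open>This makes the description in \<open>right_extend\<close> well-defined. Asking only for
  the boundary of \<open>\<psi>\<close> lets the naturality lemmas apply it to composites such as
  \<open>\<psi> \<cdot> (g \<rhd> \<theta>)\<close> after a boundary check alone.\<close>

lemma right_extend_ex1:
  assumes d: "determined K g (under s)" and s: "monad K y s"
    and p: "pushforward K g t p \<epsilon>" and g: "g \<in> hom1 K x y"
    and \<psi>: "\<psi> \<in> hom2 K (g \<odot> under t) (under s \<odot> g)"
  shows "\<exists>!\<chi>. \<chi> \<in> hom2 K (under p) (under s) \<and> \<chi> \<lhd> g = \<psi> \<cdot> \<epsilon>"
proof (rule determined_ex1[OF d])
  show "under p \<in> hom1 K (trg K g) (trg K (under s))"
    using p g s by (auto simp: pushforward_def monad_def hom1_def)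
  show "\<psi> \<cdot> \<epsilon> \<in> hom2 K (under p \<odot> g) (under s \<odot> g)"
    using p \<psi> by (auto simp: pushforward_def right_extension_def intro: vcomp_hom)
qed

lemma right_extend_props:
  assumes "determined K g (under s)" "monad K y s"
    and "pushforward K g t p \<epsilon>" "g \<in> hom1 K x y"
    and "\<psi> \<in> hom2 K (g \<odot> under t) (under s \<odot> g)"
  shows "right_extend K p \<epsilon> s (g, \<psi>) \<in> hom2 K (under p) (under s)"
    and "right_extend K p \<epsilon> s (g, \<psi>) \<lhd> g = \<psi> \<cdot> \<epsilon>"
  using theI'[OF right_extend_ex1[OF assms]] by (auto simp: right_extend_def)

text \<open>Uniqueness half of the extension property. Each naturality square follows from it, with
  \<open>\<chi>\<close> the right-hand side of the square.\<close>

lemma right_extend_eqI: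
  assumes "determined K g (under s)" "monad K y s"
    and "pushforward K g t p \<epsilon>" "g \<in> hom1 K x y"
    and "\<psi> \<in> hom2 K (g \<odot> under t) (under s \<odot> g)"
    and "\<chi> \<in> hom2 K (under p) (under s)" "\<chi> \<lhd> g = \<psi> \<cdot> \<epsilon>"
  shows "right_extend K p \<epsilon> s (g, \<psi>) = \<chi>"
  by (rule determined_eqI[OF assms(1) right_extend_props(1)[OF assms(1-5)] assms(6)])
    (simp only: assms(7) right_extend_props(2)[OF assms(1-5)])

text \<open>After whiskering with \<open>g\<close>, the pushforward laws for
  \<open>\<epsilon>\<close> replace the structure of \<open>p\<close> by that of \<open>t\<close>,
  and the colax laws for \<open>\<psi>\<close> replace that by the structure of
  \<open>s\<close>.\<close>

lemma right_extend_Mnd: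
  assumes d: "determined K g (under s)" and s: "monad K y s"
    and p: "pushforward K g t p \<epsilon>" and g: "g \<in> hom1 K x y" and t: "monad K x t"
    and c: "(g, \<psi>) \<in> Colax K g t s"
  shows "right_extend K p \<epsilon> s (g, \<psi>) \<in> Mnd K p s"
proof -
  let ?t = "under t" and ?s = "under s" and ?r = "under p"
  define \<chi> where "\<chi> = right_extend K p \<epsilon> s (g, \<psi>)"
  have \<psi>: "\<psi> \<in> hom2 K (g \<odot> ?t) (?s \<odot> g)"
    and \<psi>_eta: "\<psi> \<cdot> (g \<rhd> eta t) = eta s \<lhd> g"
    and \<psi>_mu: "\<psi> \<cdot> (g \<rhd> mu t) = (mu s \<lhd> g) \<cdot> (?s \<rhd> \<psi>) \<cdot> (\<psi> \<lhd> ?t)"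
    using c by (auto simp: Colax_def)
  have \<chi>: "\<chi> \<in> hom2 K ?r ?s" and \<chi>g: "\<chi> \<lhd> g = \<psi> \<cdot> \<epsilon>"
    using right_extend_props[OF d s p g \<psi>] by (auto simp: \<chi>_def)
  have p_eq: "\<epsilon> \<cdot> (eta p \<lhd> g) = g \<rhd> eta t"
      "\<epsilon> \<cdot> (mu p \<lhd> g) = (g \<rhd> mu t) \<cdot> (\<epsilon> \<lhd> ?t) \<cdot> (?r \<rhd> \<epsilon>)"
    using p by (auto simp: pushforward_def)
  have ob: "x \<in> Ob K" "y \<in> Ob K"
    and g1: "g \<in> One K" "src K g = x" "trg K g = y"
    and t1: "?t \<in> One K" "src K ?t = x" "trg K ?t = x"
      "?s \<in> One K" "src K ?s = y" "trg K ?s = y"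
    and e: "eta t \<in> Two K" "dom2 K (eta t) = id1 K x" "cod2 K (eta t) = ?t"
      "eta s \<in> Two K" "dom2 K (eta s) = id1 K y" "cod2 K (eta s) = ?s"
    and m: "mu t \<in> Two K" "dom2 K (mu t) = ?t \<odot> ?t" "cod2 K (mu t) = ?t"
      "mu s \<in> Two K" "dom2 K (mu s) = ?s \<odot> ?s" "cod2 K (mu s) = ?s"
    and ps: "\<psi> \<in> Two K" "dom2 K \<psi> = g \<odot> ?t" "cod2 K \<psi> = ?s \<odot> g"
    and ch: "\<chi> \<in> Two K" "dom2 K \<chi> = ?r" "cod2 K \<chi> = ?s"
    using g t s \<psi> \<chi> by (auto simp: monad_def hom1_def hom2_def)
  have r1: "?r \<in> One K" "src K ?r = y" "trg K ?r = y"
    and u: "eta p \<in> Two K" "dom2 K (eta p) = id1 K y" "cod2 K (eta p) = ?r"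
    and n: "mu p \<in> Two K" "dom2 K (mu p) = ?r \<odot> ?r" "cod2 K (mu p) = ?r"
    and E: "\<epsilon> \<in> Two K" "dom2 K \<epsilon> = ?r \<odot> g" "cod2 K \<epsilon> = g \<odot> ?t"
    using p g1 by (auto simp: pushforward_def right_extension_def monad_def hom1_def hom2_def)
  note cs = ob g1 t1 e m ps ch r1 u n E cell_simps
  have unit: "\<chi> \<cdot> eta p = eta s"
  proof (rule determined_eqI[OF d])
    show "\<chi> \<cdot> eta p \<in> hom2 K (id1 K y) ?s" "eta s \<in> hom2 K (id1 K y) ?s"
      by (simp_all add: hom2_def cs)
    have "(\<chi> \<cdot> eta p) \<lhd> g = \<psi> \<cdot> \<epsilon> \<cdot> (eta p \<lhd> g)"
      by (simp add: whisker_right_vcomp \<chi>g cs)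
    then show "(\<chi> \<cdot> eta p) \<lhd> g = eta s \<lhd> g" by (simp only: p_eq \<psi>_eta)
  qed
  have mult: "\<chi> \<cdot> mu p = mu s \<cdot> (\<chi> \<star> \<chi>)"
  proof (rule determined_eqI[OF d])
    show "\<chi> \<cdot> mu p \<in> hom2 K (?r \<odot> ?r) ?s" "mu s \<cdot> (\<chi> \<star> \<chi>) \<in> hom2 K (?r \<odot> ?r) ?s"
      by (simp_all add: hom2_def cs)
    have "(\<chi> \<cdot> mu p) \<lhd> g = \<psi> \<cdot> \<epsilon> \<cdot> (mu p \<lhd> g)"
      by (simp add: whisker_right_vcomp \<chi>g cs)
    \<comment> \<open>The brackets isolate the left-hand side of the multiplication law for
      \<open>\<psi>\<close>. That law yields two copies of \<open>\<psi>\<close>, each to be paired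
      with one of the two copies of \<open>\<epsilon>\<close>.\<close>
    also have "\<dots> = (\<psi> \<cdot> (g \<rhd> mu t)) \<cdot> (\<epsilon> \<lhd> ?t) \<cdot> (?r \<rhd> \<epsilon>)"
      by (simp only: p_eq) (simp add: cs)
    also have "\<dots> = (mu s \<lhd> g) \<cdot> (?s \<rhd> \<psi>) \<cdot> ((\<psi> \<cdot> \<epsilon>) \<lhd> ?t) \<cdot> (?r \<rhd> \<epsilon>)"
      by (simp only: \<psi>_mu) (simp add: whisker_right_vcomp cs)
    \<comment> \<open>The first pair is folded back by reading \<open>\<chi>g\<close> from right to
      left.\<close>
    also have "(\<psi> \<cdot> \<epsilon>) \<lhd> ?t = \<chi> \<lhd> (g \<odot> ?t)"
      by (simp add: cs flip: \<chi>g)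
    \<comment> \<open>Interchange moves this \<open>\<chi>\<close> past the other
      \<open>\<epsilon>\<close>, which can then meet the remaining \<open>\<psi>\<close> and form
      the second factor \<open>\<chi> \<lhd> g\<close>.\<close>
    also have "(\<chi> \<lhd> (g \<odot> ?t)) \<cdot> (?r \<rhd> \<epsilon>) = \<chi> \<star> \<epsilon>"
      by (subst interchange') (simp_all add: cs)
    also have "(?s \<rhd> \<psi>) \<cdot> (\<chi> \<star> \<epsilon>) = \<chi> \<star> (\<chi> \<lhd> g)"
      by (subst interchange') (simp_all add: \<chi>g cs)
    also have "(mu s \<lhd> g) \<cdot> (\<chi> \<star> (\<chi> \<lhd> g)) = (mu s \<cdot> (\<chi> \<star> \<chi>)) \<lhd> g"
      by (simp add: whisker_right_vcomp cs)
    finally show "(\<chi> \<cdot> mu p) \<lhd> g = (mu s \<cdot> (\<chi> \<star> \<chi>)) \<lhd> g" .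
  qed
  show ?thesis
    using \<chi> unit mult by (simp add: Mnd_def flip: \<chi>_def)
qed

text \<open>Both sides whisker to
  \<open>\<psi> \<cdot> (g \<rhd> \<theta>) \<cdot> \<epsilon>'\<close>; on the right this is the
  equation defining the pushforward of \<open>\<theta>\<close>, composed with
  \<open>\<psi>\<close>.\<close>

lemma right_extend_colax_pre:
  assumes d: "determined K g (under s)" and s: "monad K y s"
    and p: "pushforward K g t p \<epsilon>" and p': "pushforward K g t' p' \<epsilon>'"
    and g: "g \<in> hom1 K x y" and t: "monad K x t" and t': "monad K x t'"
    and \<theta>: "\<theta> \<in> Mnd K t' t" and \<psi>: "\<psi> \<in> hom2 K (g \<odot> under t) (under s \<odot> g)"
  shows "right_extend K p' \<epsilon>' s (colax_pre K \<theta> (g, \<psi>)) =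
    right_extend K p \<epsilon> s (g, \<psi>) \<cdot> pushforward_map K g p' \<epsilon>' p \<epsilon> \<theta>"
proof -
  let ?t = "under t" and ?t' = "under t'" and ?s = "under s" and ?r = "under p" and ?r' = "under p'"
  define \<chi> where "\<chi> = right_extend K p \<epsilon> s (g, \<psi>)"
  define \<phi> where "\<phi> = pushforward_map K g p' \<epsilon>' p \<epsilon> \<theta>"
  have \<chi>: "\<chi> \<in> hom2 K ?r ?s" and \<chi>g: "\<chi> \<lhd> g = \<psi> \<cdot> \<epsilon>"
    using right_extend_props[OF d s p g \<psi>] by (auto simp: \<chi>_def)
  \<comment> \<open>Since \<open>\<theta>\<close> goes from \<open>t'\<close> to \<open>t\<close>,
    the primed pushforward is the source of \<open>\<phi>\<close>.\<close>
  have \<phi>: "\<phi> \<in> hom2 K ?r' ?r" and \<phi>g: "\<epsilon> \<cdot> (\<phi> \<lhd> g) = (g \<rhd> \<theta>) \<cdot> \<epsilon>'"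
    using theI'[OF pushforward_map_ex1[OF p' p g t' t \<theta>]]
    by (auto simp: \<phi>_def pushforward_map_def)
  have g1: "g \<in> One K" "src K g = x" "trg K g = y"
    and t1: "?t \<in> One K" "src K ?t = x" "trg K ?t = x" "?t' \<in> One K" "src K ?t' = x" "trg K ?t' = x"
      "?s \<in> One K" "src K ?s = y" "trg K ?s = y"
    and th: "\<theta> \<in> Two K" "dom2 K \<theta> = ?t'" "cod2 K \<theta> = ?t"
    and ps: "\<psi> \<in> Two K" "dom2 K \<psi> = g \<odot> ?t" "cod2 K \<psi> = ?s \<odot> g"
    and ch: "\<chi> \<in> Two K" "dom2 K \<chi> = ?r" "cod2 K \<chi> = ?s"
    and ph: "\<phi> \<in> Two K" "dom2 K \<phi> = ?r'" "cod2 K \<phi> = ?r"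
    using g t t' s \<theta> \<psi> \<chi> \<phi> by (auto simp: monad_def Mnd_def hom1_def hom2_def)
  have r1: "?r \<in> One K" "src K ?r = y" "trg K ?r = y" "?r' \<in> One K" "src K ?r' = y" "trg K ?r' = y"
    and E: "\<epsilon> \<in> Two K" "dom2 K \<epsilon> = ?r \<odot> g" "cod2 K \<epsilon> = g \<odot> ?t"
      "\<epsilon>' \<in> Two K" "dom2 K \<epsilon>' = ?r' \<odot> g" "cod2 K \<epsilon>' = g \<odot> ?t'"
    using p p' g1 by (auto simp: pushforward_def right_extension_def monad_def hom1_def hom2_def)
  note cs = g1 t1 th ps ch ph r1 E cell_simps
  have "right_extend K p' \<epsilon>' s (g, \<psi> \<cdot> (g \<rhd> \<theta>)) = \<chi> \<cdot> \<phi>"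
  proof (rule right_extend_eqI[OF d s p' g])
    show "\<psi> \<cdot> (g \<rhd> \<theta>) \<in> hom2 K (g \<odot> ?t') (?s \<odot> g)" "\<chi> \<cdot> \<phi> \<in> hom2 K ?r' ?s"
      by (simp_all add: hom2_def cs)
    have "(\<chi> \<cdot> \<phi>) \<lhd> g = \<psi> \<cdot> \<epsilon> \<cdot> (\<phi> \<lhd> g)"
      by (simp add: whisker_right_vcomp \<chi>g cs)
    then show "(\<chi> \<cdot> \<phi>) \<lhd> g = (\<psi> \<cdot> (g \<rhd> \<theta>)) \<cdot> \<epsilon>'" by (simp add: \<phi>g cs)
  qed
  then show ?thesis by (simp add: colax_pre_def \<chi>_def \<phi>_def)
qed

text \<open>Whiskering preserves vertical composition, so the right-hand side whiskers to
  \<open>(\<theta> \<lhd> g) \<cdot> \<psi> \<cdot> \<epsilon>\<close>; as \<open>s'\<close> is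
  \<open>g\<close>-determined, this identifies it.\<close>

lemma right_extend_colax_post:
  assumes d: "determined K g (under s)" and s: "monad K y s"
    and d': "determined K g (under s')" and s': "monad K y s'"
    and p: "pushforward K g t p \<epsilon>" and g: "g \<in> hom1 K x y"
    and \<theta>: "\<theta> \<in> hom2 K (under s) (under s')"
    and \<psi>: "\<psi> \<in> hom2 K (g \<odot> under t) (under s \<odot> g)"
  shows "right_extend K p \<epsilon> s' (colax_post K \<theta> (g, \<psi>)) = \<theta> \<cdot> right_extend K p \<epsilon> s (g, \<psi>)"
proof -
  let ?s = "under s" and ?s' = "under s'" and ?r = "under p"
  define \<chi> where "\<chi> = right_extend K p \<epsilon> s (g, \<psi>)"
  have \<chi>: "\<chi> \<in> hom2 K ?r ?s" and \<chi>g: "\<chi> \<lhd> g = \<psi> \<cdot> \<epsilon>"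
    using right_extend_props[OF d s p g \<psi>] by (auto simp: \<chi>_def)
  have cs: "g \<in> One K" "src K g = x" "trg K g = y" "src K ?s = y"
    "\<theta> \<in> Two K" "dom2 K \<theta> = ?s" "cod2 K \<theta> = ?s'"
    "\<psi> \<in> Two K" "dom2 K \<psi> = g \<odot> under t" "cod2 K \<psi> = ?s \<odot> g"
    "\<chi> \<in> Two K" "dom2 K \<chi> = ?r" "cod2 K \<chi> = ?s"
    "\<epsilon> \<in> Two K" "cod2 K \<epsilon> = g \<odot> under t" "src K ?r = y"
    using g s \<theta> \<psi> \<chi> p
    by (auto simp: pushforward_def right_extension_def monad_def hom1_def hom2_def)
  have "right_extend K p \<epsilon> s' (g, (\<theta> \<lhd> g) \<cdot> \<psi>) = \<theta> \<cdot> \<chi>"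
  proof (rule right_extend_eqI[OF d' s' p g])
    show "(\<theta> \<lhd> g) \<cdot> \<psi> \<in> hom2 K (g \<odot> under t) (?s' \<odot> g)" "\<theta> \<cdot> \<chi> \<in> hom2 K ?r ?s'"
      by (simp_all add: hom2_def cs cell_simps)
    show "(\<theta> \<cdot> \<chi>) \<lhd> g = ((\<theta> \<lhd> g) \<cdot> \<psi>) \<cdot> \<epsilon>"
      by (simp add: whisker_right_vcomp \<chi>g cs cell_simps)
  qed
  then show ?thesis by (simp add: colax_post_def \<chi>_def)
qed

text \<open>The counit is not claimed to be monic: its universal property cancels it only in front
  of cells of the form \<open>\<alpha> \<lhd> g\<close>, which is all that occurs here.\<close>

lemma right_extend_monic:
  assumes d: "determined K g (under s)" and s: "monad K y s"
    and p: "pushforward K g t p \<epsilon>" and g: "g \<in> hom1 K x y"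
    and \<psi>: "\<psi> \<in> hom2 K (g \<odot> under t) (under s \<odot> g)" and mono: "monic K x y \<psi>"
  shows "monic K y y (right_extend K p \<epsilon> s (g, \<psi>))"
proof -
  let ?s = "under s" and ?r = "under p" and ?gt = "g \<odot> under t"
  define \<chi> where "\<chi> = right_extend K p \<epsilon> s (g, \<psi>)"
  have \<chi>: "\<chi> \<in> hom2 K ?r ?s" and \<chi>g: "\<chi> \<lhd> g = \<psi> \<cdot> \<epsilon>"
    using right_extend_props[OF d s p g \<psi>] by (auto simp: \<chi>_def)
  have ext: "right_extension K g ?gt ?r \<epsilon>" and \<epsilon>: "\<epsilon> \<in> hom2 K (?r \<odot> g) ?gt"
    using p by (auto simp: pushforward_def right_extension_def)
  have r1: "?r \<in> hom1 K y y" and s1: "?s \<in> hom1 K y y"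
    using p g s by (auto simp: pushforward_def monad_def hom1_def)
  \<comment> \<open>The boundary in \<open>monic\<close> is existentially quantified, but a 2-cell
    determines its boundary, so the domain of \<open>\<psi>\<close> there is
    \<open>?gt\<close>.\<close>
  have cancel: "\<alpha> = \<beta>" if "h \<in> hom1 K x y" "\<alpha> \<in> hom2 K h ?gt" "\<beta> \<in> hom2 K h ?gt" "\<psi> \<cdot> \<alpha> = \<psi> \<cdot> \<beta>"
    for h \<alpha> \<beta>
    using mono \<psi> that unfolding monic_def hom2_def by auto
  have "\<alpha> = \<beta>"
    if h: "h \<in> hom1 K y y" and \<alpha>: "\<alpha> \<in> hom2 K h ?r" and \<beta>: "\<beta> \<in> hom2 K h ?r"
      and eq: "\<chi> \<cdot> \<alpha> = \<chi> \<cdot> \<beta>" for h \<alpha> \<beta>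
  \<comment> \<open>The argument runs backwards: universality of \<open>\<epsilon>\<close> reduces
    the goal to an equation behind \<open>\<epsilon>\<close>, and monicity of \<open>\<psi>\<close>
    to one behind \<open>\<psi> \<cdot> \<epsilon>\<close>. The latter is \<open>eq\<close>
    whiskered with \<open>g\<close>.\<close>
  proof (rule right_extension_eqI[OF ext \<alpha> \<beta>], rule cancel)
    show "h \<odot> g \<in> hom1 K x y" using g h by (rule comp1_hom)
    have wh: "\<gamma> \<lhd> g \<in> hom2 K (h \<odot> g) (?r \<odot> g)" if "\<gamma> \<in> hom2 K h ?r" for \<gamma>
      using g h that by (intro hcomp_hom id2_hom) (auto simp: hom1_def)
    show "\<epsilon> \<cdot> (\<alpha> \<lhd> g) \<in> hom2 K (h \<odot> g) ?gt" "\<epsilon> \<cdot> (\<beta> \<lhd> g) \<in> hom2 K (h \<odot> g) ?gt"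
      using \<epsilon> wh \<alpha> \<beta> by (blast intro: vcomp_hom)+
    have "\<psi> \<cdot> \<epsilon> \<cdot> (\<gamma> \<lhd> g) = (\<chi> \<cdot> \<gamma>) \<lhd> g" if "\<gamma> \<in> hom2 K h ?r" for \<gamma>
      using that \<chi> g h vcomp_assoc[OF wh[OF that] \<epsilon> \<psi>]
      by (simp add: whisker_right_vcomp \<chi>g hom1_def hom2_def)
    then show "\<psi> \<cdot> \<epsilon> \<cdot> (\<alpha> \<lhd> g) = \<psi> \<cdot> \<epsilon> \<cdot> (\<beta> \<lhd> g)"
      using \<alpha> \<beta> eq by simp
  qed
  then have "monic K y y \<chi>"
    unfolding monic_def using r1 s1 \<chi> by blast
  then show ?thesis by (simp add: \<chi>_def)
qed

end

theorem theorem1p15: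
  fixes K :: "('o, 'm, 'c) two_cat" (structure)
    and g :: 'm and x y :: 'o and t s p :: "('m, 'c) mnd" and \<epsilon> :: 'c
  assumes "two_category K"
    and "g \<in> hom1 K x y"
    and "monad K x t"
    and "monad K y s" and "determined K g (under s)"
    and "pushforward K g t p \<epsilon>"
  shows
    "(\<forall>\<psi>. (g, \<psi>) \<in> Colax K g t s \<longrightarrow>
        (\<exists>!\<chi>. \<chi> \<in> hom2 K (under p) (under s) \<and> \<chi> \<lhd> g = \<psi> \<cdot> \<epsilon>)) \<and>
     right_extend K p \<epsilon> s \<in> Colax K g t s \<rightarrow> Mnd K p s \<and>
     (\<forall>t' p' \<epsilon>' \<theta>. monad K x t' \<and> pushforward K g t' p' \<epsilon>' \<and> \<theta> \<in> Mnd K t' t \<longrightarrow>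
        (\<forall>c \<in> Colax K g t s.
           right_extend K p' \<epsilon>' s (colax_pre K \<theta> c) =
           right_extend K p \<epsilon> s c \<cdot> pushforward_map K g p' \<epsilon>' p \<epsilon> \<theta>)) \<and>
     (\<forall>s' \<theta>. monad K y s' \<and> determined K g (under s') \<and> \<theta> \<in> Mnd K s s' \<longrightarrow>
        (\<forall>c \<in> Colax K g t s.
           right_extend K p \<epsilon> s' (colax_post K \<theta> c) = \<theta> \<cdot> right_extend K p \<epsilon> s c)) \<and>
     (\<forall>\<psi>. (g, \<psi>) \<in> Colax K g t s \<and> monic K x y \<psi> \<longrightarrow>
        monic K y y (right_extend K p \<epsilon> s (g, \<psi>)))"
proof -
  interpret two_category K by fact
  note g = assms(2) and t = assms(3) and s = assms(4) and d = assms(5) and p = assms(6)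
  have Colax_hom2: "\<psi> \<in> hom2 K (g \<odot> under t) (under s \<odot> g)" if "(g, \<psi>) \<in> Colax K g t s" for \<psi>
    using that by (simp add: Colax_def)
  \<comment> \<open>The lemmas above speak of explicit pairs, while the function-space and
    naturality claims range over arbitrary elements \<open>c\<close>.\<close>
  have Colax_E: "\<exists>\<psi>. c = (g, \<psi>)" if "c \<in> Colax K g t s" for c
    using that by (auto simp: Colax_def)
  show ?thesis
  proof (intro conjI allI impI ballI funcsetI; (elim conjE)?)
    fix \<psi> assume "(g, \<psi>) \<in> Colax K g t s"
    then show "\<exists>!\<chi>. \<chi> \<in> hom2 K (under p) (under s) \<and> \<chi> \<lhd> g = \<psi> \<cdot> \<epsilon>"
      by (intro right_extend_ex1[OF d s p g] Colax_hom2)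
  next
    fix c assume "c \<in> Colax K g t s"
    then show "right_extend K p \<epsilon> s c \<in> Mnd K p s"
      using right_extend_Mnd[OF d s p g t] Colax_E by metis
  next
    fix t' p' \<epsilon>' \<theta> c
    assume "monad K x t'" "pushforward K g t' p' \<epsilon>'" "\<theta> \<in> Mnd K t' t" "c \<in> Colax K g t s"
    then show "right_extend K p' \<epsilon>' s (colax_pre K \<theta> c) =
        right_extend K p \<epsilon> s c \<cdot> pushforward_map K g p' \<epsilon>' p \<epsilon> \<theta>"
      using right_extend_colax_pre[OF d s p _ g t] Colax_E Colax_hom2 by metis
  next
    fix s' \<theta> c
    assume "monad K y s'" "determined K g (under s')" "\<theta> \<in> Mnd K s s'" "c \<in> Colax K g t s"
    moreover from this have "\<theta> \<in> hom2 K (under s) (under s')"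
      by (simp add: Mnd_def)
    ultimately show "right_extend K p \<epsilon> s' (colax_post K \<theta> c) = \<theta> \<cdot> right_extend K p \<epsilon> s c"
      using right_extend_colax_post[OF d s _ _ p g] Colax_E Colax_hom2 by metis
  next
    fix \<psi> assume "(g, \<psi>) \<in> Colax K g t s" "monic K x y \<psi>"
    then show "monic K y y (right_extend K p \<epsilon> s (g, \<psi>))"
      by (intro right_extend_monic[OF d s p g] Colax_hom2)
  qed
qed

end
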